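(* Let $\mathbb{K}$ be a field, $c\ge 2$ a natural number and $R=\mathbb{K}[x_{i,j}\mid 1\le i\le c,\ j\in\mathbb{N}]$. Then there are infinitely many distinct $\mathrm{Inc}(\mathbb{N})$-compatible term orders on $R$.
   Context: $\mathbb{N}=\{1,2,3,\dots\}$. $\mathrm{Inc}(\mathbb{N})$ is the monoid of strictly increasing functions $p:\mathbb{N}\to\mathbb{N}$; it acts on monomials of $R$ by $p\cdot(x_{i_1,j_1}^{e_1}\cdots x_{i_r,j_r}^{e_r})=x_{i_1,p(j_1)}^{e_1}\cdots x_{i_r,p(j_r)}^{e_r}$. A term order $\preceq$ on $R$ is a total order on the monomials of $R$ that respects multiplication and satisfies $1\preceq f$ for every monomial $f$. It is $\mathrm{Inc}(\mathbb{N})$-compatible if $f\preceq g$ implies $p\cdot f\preceq p\cdot g$ for all monomials $f,g\in R$ and all $p\in\mathrm{Inc}(\mathbb{N})$. *)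

theory Defs
  imports "HOL-Library.Poly_Mapping" "HOL-Library.FuncSet"
begin

type_synonym exponents = "(nat \<times> nat) \<Rightarrow>\<^sub>0 nat"
type_synonym 'k mpoly = "exponents \<Rightarrow>\<^sub>0 'k"

definition var :: "nat \<Rightarrow> nat \<Rightarrow> 'k::field mpoly" where
  "var i j = Poly_Mapping.single (Poly_Mapping.single (i, j) 1) 1"

definition poly_ring :: "nat \<Rightarrow> 'k::field mpoly set" where
  "poly_ring c = {f. \<forall>e\<in>Poly_Mapping.keys f. Poly_Mapping.keys e \<subseteq> {1..c} \<times> {1..}}"

definition monomials :: "nat \<Rightarrow> 'k::field mpoly set" where
  "monomials c = {f \<in> poly_ring c. \<exists>e. f = Poly_Mapping.single e 1}"

lemma single_eq_prod_var:
  "(Poly_Mapping.single e 1 :: 'k::field mpoly) =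
     (\<Prod>(i, j)\<in>Poly_Mapping.keys e. var i j ^ Poly_Mapping.lookup e (i, j))"
proof -
  have pow: "(var i j :: 'k mpoly) ^ n
      = Poly_Mapping.single (Poly_Mapping.single (i, j) n) 1" for i j n
    by (induction n) (simp_all add: var_def mult_single flip: single_add)
  have sum: "(\<Prod>x\<in>A. Poly_Mapping.single (g x) (1::'k)) = Poly_Mapping.single (\<Sum>x\<in>A. g x) 1"
    if "finite A" for A :: "(nat \<times> nat) set" and g :: "nat \<times> nat \<Rightarrow> exponents"
    using that by (induction A rule: finite_induct) (simp_all add: mult_single)
  have "e = (\<Sum>x\<in>Poly_Mapping.keys e. Poly_Mapping.single x (Poly_Mapping.lookup e x))"
    by (rule poly_mapping_eqI)
       (simp add: lookup_sum lookup_single when_def in_keys_iff)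
  then show ?thesis
    by (simp add: pow case_prod_unfold sum)
qed

text \<open>The set \<open>\<nat> = {1, 2, 3, \<dots>}\<close> is \<open>{1..}\<close>; the value of a member of \<open>Inc\<close> at \<open>0\<close> is irrelevant.\<close>

definition Inc :: "(nat \<Rightarrow> nat) set" where
  "Inc = {p \<in> {1..} \<rightarrow> {1..}. strict_mono_on {1..} p}"

text \<open>The action extended linearly from monomials to polynomials.\<close>

definition inc_act :: "(nat \<Rightarrow> nat) \<Rightarrow> 'k::field mpoly \<Rightarrow> 'k mpoly" where
  "inc_act p f = (\<Sum>e\<in>Poly_Mapping.keys f. Poly_Mapping.single 0 (Poly_Mapping.lookup f e) *
     (\<Prod>(i, j)\<in>Poly_Mapping.keys e. var i (p j) ^ Poly_Mapping.lookup e (i, j)))"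

lemma inc_act_single:
  "inc_act p (Poly_Mapping.single e 1 :: 'k::field mpoly) =
     (\<Prod>(i, j)\<in>Poly_Mapping.keys e. var i (p j) ^ Poly_Mapping.lookup e (i, j))"
  by (simp add: inc_act_def)

definition term_order :: "nat \<Rightarrow> ('k::field mpoly) rel \<Rightarrow> bool" where
  "term_order c r \<longleftrightarrow>
     linear_order_on (monomials c) r \<and>
     (\<forall>f\<in>monomials c. \<forall>g\<in>monomials c. \<forall>h\<in>monomials c. (f, g) \<in> r \<longrightarrow> (f * h, g * h) \<in> r) \<and>
     (\<forall>f\<in>monomials c. (1, f) \<in> r)"

definition inc_compatible :: "nat \<Rightarrow> ('k::field mpoly) rel \<Rightarrow> bool" where
  "inc_compatible c r \<longleftrightarrow>
     (\<forall>f\<in>monomials c. \<forall>g\<in>monomials c. \<forall>p\<in>Inc. (f, g) \<in> r \<longrightarrow> (inc_act p f, inc_act p g) \<in> r)"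

end

(* Order monomials first by a total degree in which row 1 of the variables carries weight w 1 and the
   other rows w 2, w 3, ..., and break ties lexicographically. Shifting second indices by an increasing
   map changes neither the weighted degree nor the relative position of two variables, so every choice
   of weights gives a compatible term order. The weights (2 * n, 1, 1, ...) give distinct orders,
   because x_{1,1} and x_{2,1}^m compare like 2 * n and m. *)

theory Submission
  imports Defs "HOL-Library.Product_Lexorder"
begin

abbreviation monom :: "exponents \<Rightarrow> 'k::field mpoly" where
  "monom e \<equiv> Poly_Mapping.single e 1"

definition exps :: "nat \<Rightarrow> exponents set" where
  "exps c = {e. Poly_Mapping.keys e \<subseteq> {1..c} \<times> {1..}}"

lemma monomials_eq: "monomials c = (monom ` exps c :: 'k::field mpoly set)"
  by (auto simp: monomials_def poly_ring_def exps_def)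

lemma monom_eq_iff [simp]: "(monom e :: 'k::field mpoly) = monom e' \<longleftrightarrow> e = e'"
proof
  assume "(monom e :: 'k mpoly) = monom e'"
  then have "Poly_Mapping.keys (monom e :: 'k mpoly) = Poly_Mapping.keys (monom e' :: 'k mpoly)"
    by simp
  then show "e = e'" by simp
qed simp

lemma exps_add: "e \<in> exps c \<Longrightarrow> e' \<in> exps c \<Longrightarrow> e + e' \<in> exps c"
  using keys_add[of e e'] by (auto simp: exps_def)

text \<open>The action carried over to exponents, where the comparison \<open><\<close> takes place;
  \<open>inc_act_monom\<close> links it to \<open>inc_act\<close>.\<close>

definition shift :: "(nat \<Rightarrow> nat) \<Rightarrow> exponents \<Rightarrow> exponents" where
  "shift p e = (\<Sum>(i, j)\<in>Poly_Mapping.keys e.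
     Poly_Mapping.single (i, p j) (Poly_Mapping.lookup e (i, j)))"

lemma var_power: "(var i j :: 'k::field mpoly) ^ n = monom (Poly_Mapping.single (i, j) n)"
  by (induction n) (simp_all add: var_def mult_single flip: single_add)

lemma prod_monom: "finite A \<Longrightarrow> (\<Prod>x\<in>A. monom (g x) :: 'k::field mpoly) = monom (\<Sum>x\<in>A. g x)"
  by (induction A rule: finite_induct) (simp_all add: mult_single)

lemma inc_act_monom: "inc_act p (monom e :: 'k::field mpoly) = monom (shift p e)"
  by (simp add: inc_act_single shift_def var_power prod_monom case_prod_unfold)

text \<open>As \<open>p\<close> is injective on \<open>{1..}\<close>, only the key
  \<open>(i, j)\<close> can contribute at \<open>(i, p j)\<close>. Membership in
  \<open>exps c\<close> excludes column 0, where \<open>p\<close> is unconstrained.\<close>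

lemma lookup_shift:
  assumes "p \<in> Inc" "e \<in> exps c" "1 \<le> j"
  shows "Poly_Mapping.lookup (shift p e) (i, p j) = Poly_Mapping.lookup e (i, j)"
proof -
  have inj: "p j' = p j \<longleftrightarrow> j' = j" if "1 \<le> j'" for j'
    using assms that strict_mono_on_eqD[of "{1..}" p j' j] by (auto simp: Inc_def)
  have "Poly_Mapping.lookup (shift p e) (i, p j) =
      (\<Sum>k\<in>Poly_Mapping.keys e. if k = (i, j) then Poly_Mapping.lookup e k else 0)"
    unfolding shift_def lookup_sum
  proof (rule sum.cong, goal_cases)
    case (2 k)
    with assms have "1 \<le> snd k" by (auto simp: exps_def)
    then show ?case using inj[of "snd k"]
      by (cases k) (auto simp: lookup_single when_def)
  qed simp
  then show ?thesis by (simp add: in_keys_iff)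
qed

lemma keys_shift:
  "Poly_Mapping.keys (shift p e) \<subseteq> (\<lambda>(i, j). (i, p j)) ` Poly_Mapping.keys e"
proof -
  have "Poly_Mapping.keys (shift p e) \<subseteq> (\<Union>k\<in>Poly_Mapping.keys e.
      Poly_Mapping.keys (Poly_Mapping.single (fst k, p (snd k)) (Poly_Mapping.lookup e k)))"
    unfolding shift_def case_prod_unfold prod.collapse by (rule keys_sum)
  then show ?thesis by (fastforce split: if_splits)
qed

lemma shift_exps: "p \<in> Inc \<Longrightarrow> e \<in> exps c \<Longrightarrow> shift p e \<in> exps c"
  using keys_shift[of p e] by (fastforce simp: exps_def Inc_def)

text \<open>\<open><\<close> is decided at the first position, in the lexicographic order on pairs,
  where the exponents differ. That position \<open>(i, j)\<close> moves to \<open>(i, p j)\<close>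
  and remains the first difference.\<close>

lemma shift_less:
  assumes p: "p \<in> Inc" and e: "e \<in> exps c" "e' \<in> exps c" and less: "e < e'"
  shows "shift p e < shift p e'"
proof -
  from less obtain k where "Poly_Mapping.lookup e k < Poly_Mapping.lookup e' k"
    and "\<forall>k'<k. Poly_Mapping.lookup e k' = Poly_Mapping.lookup e' k'"
    by (auto simp: less_poly_mapping.rep_eq less_fun_def)
  then obtain i j where k: "Poly_Mapping.lookup e (i, j) < Poly_Mapping.lookup e' (i, j)"
    and eq: "\<And>k'. k' < (i, j) \<Longrightarrow> Poly_Mapping.lookup e k' = Poly_Mapping.lookup e' k'"
    by (metis prod.collapse)
  from k have "(i, j) \<in> Poly_Mapping.keys e'" by (auto simp: in_keys_iff)
  with e have j: "1 \<le> j" by (auto simp: exps_def)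
  have "Poly_Mapping.lookup (shift p e) (a, b) = Poly_Mapping.lookup (shift p e') (a, b)"
    if ab: "(a, b) < (i, p j)" for a b
  proof (cases "b \<in> p ` {1..}")
    case True
    then obtain b' where b: "b = p b'" "1 \<le> b'" by auto
    \<comment> \<open>A strictly increasing \<open>p\<close> also reflects the order of columns, so
      an earlier position comes from an earlier one.\<close>
    have "p b' < p j \<Longrightarrow> b' < j"
      using p b j strict_mono_on_less[of "{1..}" p b' j] by (auto simp: Inc_def)
    with ab b have "(a, b') < (i, j)" by auto
    with p e b eq show ?thesis by (simp add: lookup_shift)
  next
    case False
    \<comment> \<open>Columns outside the image of \<open>p\<close> are empty in both shifted
      exponents.\<close>
    have "(a, b) \<notin> Poly_Mapping.keys (shift p f)" if "f \<in> exps c" for f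
      using keys_shift[of p f] that False by (fastforce simp: exps_def)
    with e show ?thesis by (simp add: in_keys_iff)
  qed
  moreover have "Poly_Mapping.lookup (shift p e) (i, p j) < Poly_Mapping.lookup (shift p e') (i, p j)"
    using p e j k by (simp add: lookup_shift)
  ultimately show ?thesis
    unfolding less_poly_mapping.rep_eq less_fun_def by (intro exI[of _ "(i, p j)"]) auto
qed

definition weight :: "(nat \<Rightarrow> nat) \<Rightarrow> exponents \<Rightarrow> nat" where
  "weight w e = (\<Sum>k\<in>Poly_Mapping.keys e. w (fst k) * Poly_Mapping.lookup e k)"

text \<open>Lets the weights of \<open>e\<close>, \<open>e'\<close> and \<open>e + e'\<close> be
  summed over one index set in \<open>weight_add\<close>.\<close>

lemma weight_superset:
  assumes "finite A" "Poly_Mapping.keys e \<subseteq> A"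
  shows "weight w e = (\<Sum>k\<in>A. w (fst k) * Poly_Mapping.lookup e k)"
  unfolding weight_def using assms by (intro sum.mono_neutral_left) (auto simp: in_keys_iff)

lemma weight_add: "weight w (e + e') = weight w e + weight w e'"
  using keys_add[of e e']
  by (simp add: weight_superset[of "Poly_Mapping.keys e \<union> Poly_Mapping.keys e'"]
      lookup_add algebra_simps sum.distrib)

lemma weight_single [simp]: "weight w (Poly_Mapping.single k n) = w (fst k) * n"
  by (simp add: weight_def)

lemma weight_zero [simp]: "weight w 0 = 0"
  by (simp add: weight_def)

text \<open>A shift moves each variable within its row, and \<open>w\<close> sees only the row;
  additivity reduces the claim to powers of single variables.\<close>

lemma weight_shift: "weight w (shift p e) = weight w e"
proof -
  have "weight w (\<Sum>k\<in>A. g k) = (\<Sum>k\<in>A. weight w (g k))" if "finite A"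
    for A :: "(nat \<times> nat) set" and g
    using that by (induction A rule: finite_induct) (simp_all add: weight_add)
  then show ?thesis by (simp add: shift_def case_prod_unfold weight_def[of w e])
qed

text \<open>Pairs are compared lexicographically. This pulls a linear order back along the injective
  map from \<open>e\<close> to \<open>(weight w e, e)\<close>, so even zero weights give a linear
  order.\<close>

definition worder :: "nat \<Rightarrow> (nat \<Rightarrow> nat) \<Rightarrow> ('k::field mpoly) rel" where
  "worder c w = {(monom e, monom e') | e e'.
     e \<in> exps c \<and> e' \<in> exps c \<and> (weight w e, e) \<le> (weight w e', e')}"

lemma worder_iff:
  "((monom e, monom e') :: 'k::field mpoly \<times> 'k mpoly) \<in> worder c w \<longleftrightarrow>
     e \<in> exps c \<and> e' \<in> exps c \<and> (weight w e, e) \<le> (weight w e', e')"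
  by (auto simp: worder_def)

lemma exponents_nonneg: "(0 :: exponents) \<le> e"
proof -
  have "\<not> e < 0" by (auto simp: less_poly_mapping.rep_eq less_fun_def)
  then show ?thesis by simp
qed

lemma term_order_worder: "term_order c (worder c w :: ('k::field mpoly) rel)"
  unfolding term_order_def
proof (intro conjI)
  show "linear_order_on (monomials c) (worder c w :: 'k mpoly rel)"
    unfolding linear_order_on_def partial_order_on_def preorder_on_def
    by (auto simp: monomials_eq worder_def refl_on_def total_on_def intro!: transI antisymI)
  \<comment> \<open>Products add exponents, and both components of the pair have
    translation-invariant orders.\<close>
  show "\<forall>f\<in>monomials c. \<forall>g\<in>monomials c. \<forall>h\<in>monomials c.
      (f, g) \<in> worder c w \<longrightarrow> (f * h, g * h) \<in> (worder c w :: 'k mpoly rel)"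
    by (auto simp: monomials_eq mult_single worder_iff exps_add weight_add add_right_mono)
  \<comment> \<open>\<open>1\<close> is \<open>monom 0\<close>, of weight 0; against another
    monomial of weight 0, \<open>exponents_nonneg\<close> decides.\<close>
  show "\<forall>f\<in>monomials c. (1, f) \<in> (worder c w :: 'k mpoly rel)"
    by (auto simp: monomials_eq worder_iff exps_def exponents_nonneg simp flip: single_one)
qed

lemma inc_compatible_worder: "inc_compatible c (worder c w :: ('k::field mpoly) rel)"
  unfolding inc_compatible_def
  by (auto simp: monomials_eq inc_act_monom worder_iff shift_exps weight_shift order_le_less
      intro: shift_less)

lemma worder_eq_imp_le:
  assumes c: "2 \<le> c"
    and eq: "(worder c (\<lambda>i. if i = 1 then 2 * m else 1) :: ('k::field mpoly) rel) =
      worder c (\<lambda>i. if i = 1 then 2 * n else 1)"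
  shows "m \<le> n"
proof (rule ccontr)
  assume "\<not> m \<le> n"
  define e where "e = (Poly_Mapping.single (1, 1) 1 :: exponents)"
  \<comment> \<open>The odd exponent rules out ties with the even weight \<open>2 * k\<close> of
    \<open>e\<close>, so the weights alone decide: \<open>2 * k < 2 * n + 1\<close> iff
    \<open>k \<le> n\<close>.\<close>
  define e' where "e' = (Poly_Mapping.single (2, 1) (2 * n + 1) :: exponents)"
  have "e \<in> exps c" "e' \<in> exps c"
    using c by (auto simp: e_def e'_def exps_def)
  then have "((monom e, monom e') :: 'k mpoly \<times> 'k mpoly) \<in> worder c (\<lambda>i. if i = 1 then 2 * k else 1)
      \<longleftrightarrow> k \<le> n" for k
    by (auto simp: worder_iff e_def e'_def)
  \<comment> \<open>At \<open>k = n\<close> the pair lies in the right-hand order, at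
    \<open>k = m\<close> it is missing from the left-hand one.\<close>
  with eq \<open>\<not> m \<le> n\<close> show False by blast
qed

theorem mainTheorem6:
  fixes c :: nat
  assumes "c \<ge> 2"
  shows "infinite {r :: ('k::field mpoly) rel. term_order c r \<and> inc_compatible c r}"
proof -
  let ?r = "\<lambda>n. worder c (\<lambda>i. if i = 1 then 2 * n else 1) :: 'k mpoly rel"
  have "inj ?r"
    by (intro injI order_antisym) (erule worder_eq_imp_le[OF assms], erule worder_eq_imp_le[OF assms sym])
  then have "infinite (range ?r)" by (simp add: finite_image_iff)
  then show ?thesis
    by (rule infinite_super[rotated]) (auto simp: term_order_worder inc_compatible_worder)
qed

end
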